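(* Let $p\in\mathbb N$ with $(p+1)\alpha>1$, let $F_a\in C_b^{p+1}(\mathbb R^e;\mathbb R^e)$ for $a\in\mathcal A=\{1,\dots,m\}$, and let $Z:[0,T]\to\mathbb R^m$ be the path component of an $\mathbf X$-controlled rough path (in particular $Z$ is $\alpha$-Hölder). Assume that the simplified controlled Runge-Kutta method with tableau $(A,b)$, $A\in\mathbb R^{q\times q}$, $b\in\mathbb R^q$, has solvable stage systems at each step and has tree order $p$, i.e. $\widehat a(\tau)=1/\gamma(\tau)$ for all $\tau\in\mathcal T_{\le p}$. For a partition $\pi_h=\{0=t_0<\cdots<t_N=T\}$ of $[0,T]$ let $Y^h$ be the solution of $dY^h_t=\sum_{a=1}^mF_a(Y^h_t)\,dZ^{h,a}_t$, $Y^h_0=y_0$, where $Z^h$ is the piecewise linear interpolation of $Z$ along $\pi_h$. Then, for every $R>0$, there exists a constant $C_{p,R,T}>0$ (independent of the partition and of $n$) such that, whenever $|Y^h_{t_n}|\le R$, $$\bigl|Y^h_{t_{n+1}}-\Psi^{\mathrm{SCRK}}_{t_n,t_{n+1}}(Y^h_{t_n})\bigr|\le C_{p,R,T}\,h_n^{(p+1)\alpha},\qquad h_n=t_{n+1}-t_n,$$ for every grid interval $[t_n,t_{n+1}]$.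
   Context: Fix $\alpha\in(1/3,1/2]$, $T>0$, $m,e,q\in\mathbb N$. $C_b^k$ denotes $k$ times continuously differentiable maps with all derivatives of orders $0,\dots,k$ bounded. An $\mathbf X$-controlled rough path ($\mathbf X=(X,\mathbb X)$ an $\alpha$-Hölder rough path over $\mathbb R^d$) is a pair $(Z,Z')$ of $\alpha$-Hölder paths with $Z_t-Z_s-Z'_s(X_t-X_s)=O(|t-s|^{2\alpha})$. Interpolation: $Z^h_t=Z_{t_n}+\frac{t-t_n}{h_n}(Z_{t_{n+1}}-Z_{t_n})$ for $t\in(t_n,t_{n+1}]$, $Z^h_0=Z_0$; $Y^h$ solves, on each $(t_n,t_{n+1})$, the ODE $\frac{d}{dt}Y^h_t=\sum_aF_a(Y^h_t)\frac{Z^a_{t_{n+1}}-Z^a_{t_n}}{h_n}$. Simplified controlled Runge-Kutta method: with $\Delta Z^a_{u,v}=Z^a_v-Z^a_u$ and $A=(a_{ij})$, the stages are $Y_i^{u,v}(y)=y+\sum_{a=1}^m\sum_{j=1}^qa_{ij}\Delta Z^a_{u,v}F_a(Y_j^{u,v}(y))$, $i=1,\dots,q$, and $\Psi^{\mathrm{SCRK}}_{u,v}(y)=y+\sum_{a=1}^m\sum_{i=1}^qb_i\Delta Z^a_{u,v}F_a(Y_i^{u,v}(y))$ (the stages being a solution of the stage system, assumed solvable at each step when $A$ is not strictly lower triangular). Trees: $\mathcal T$ is the set of (nonplanar) rooted trees with vertices decorated by $\mathcal A$, $\mathbf 1$ the empty tree, $[\tau_1\cdots\tau_n]_a$ the tree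 obtained by joining the roots of $\tau_1,\dots,\tau_n$ to a new root decorated by $a$, $\bullet_a=[\mathbf 1]_a$, $|\tau|$ the number of vertices, $\mathcal T_{\le p}=\{\tau\in\mathcal T:|\tau|\le p\}$. Tree factorial: $\gamma(\mathbf 1)=\gamma(\bullet_a)=1$, $\gamma(\tau)=|\tau|\prod_{i=1}^k\gamma(\tau_i)$ for $\tau=[\tau_1\cdots\tau_k]_a$. With $\odot$ the componentwise product on $\mathbb R^q$ and $\mathbf 1_q=(1,\dots,1)^\top$ (the empty product): $\widehat\Phi(\mathbf 1)=\mathbf 1_q$, $\widehat\Phi([\tau_1\cdots\tau_n]_a)=A(\widehat\Phi(\tau_1)\odot\cdots\odot\widehat\Phi(\tau_n))$, $\widehat a(\mathbf 1)=1$, $\widehat a([\tau_1\cdots\tau_n]_a)=\langle b,\widehat\Phi(\tau_1)\odot\cdots\odot\widehat\Phi(\tau_n)\rangle_{\mathbb R^q}$. *)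

theory Defs
  imports "HOL-Analysis.Analysis" "HOL-Library.Multiset"
begin

section \<open>Functions with bounded derivatives\<close>

text \<open>Iterated derivatives are taken direction by direction. As the domain is finite-dimensional,
  boundedness and continuity of all iterated directional derivatives amounts to boundedness and
  continuity of the multilinear derivatives of order up to \<open>k\<close>.\<close>

primrec C_b :: "nat \<Rightarrow> ('a::euclidean_space \<Rightarrow> 'b::real_normed_vector) \<Rightarrow> bool" where
  "C_b 0 f \<longleftrightarrow> continuous_on UNIV f \<and> bounded (range f)"
| "C_b (Suc k) f \<longleftrightarrow> bounded (range f) \<and> (\<forall>x. f differentiable (at x)) \<and>
     (\<forall>v. C_b k (\<lambda>x. frechet_derivative f (at x) v))"

section \<open>Rough paths and controlled paths on \<open>[0,T]\<close>\<close>

definition holder_on :: "real \<Rightarrow> real set \<Rightarrow> (real \<Rightarrow> 'a::real_normed_vector) \<Rightarrow> bool" where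
  "holder_on \<alpha> S f \<longleftrightarrow> (\<exists>C. \<forall>s\<in>S. \<forall>t\<in>S. norm (f t - f s) \<le> C * \<bar>t - s\<bar> powr \<alpha>)"

text \<open>The second component is the two-parameter second-order process; the second conjunct is
  Chen's relation. Geometricity is not required.\<close>

definition rough_path ::
    "real \<Rightarrow> real \<Rightarrow> (real \<Rightarrow> real^'d) \<Rightarrow> (real \<Rightarrow> real \<Rightarrow> real^'d^'d) \<Rightarrow> bool" where
  "rough_path \<alpha> T X XX \<longleftrightarrow>
     holder_on \<alpha> {0..T} X \<and>
     (\<forall>s\<in>{0..T}. \<forall>u\<in>{0..T}. \<forall>t\<in>{0..T}. \<forall>i j.
        XX s t $ i $ j - XX s u $ i $ j - XX u t $ i $ j = (X u - X s) $ i * (X t - X u) $ j) \<and>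
     (\<exists>C. \<forall>s\<in>{0..T}. \<forall>t\<in>{0..T}. norm (XX s t) \<le> C * \<bar>t - s\<bar> powr (2 * \<alpha>))"

definition controlled_path ::
    "real \<Rightarrow> real \<Rightarrow> (real \<Rightarrow> real^'d) \<Rightarrow> (real \<Rightarrow> real^'m) \<Rightarrow> (real \<Rightarrow> real^'d^'m) \<Rightarrow> bool" where
  "controlled_path \<alpha> T X Z Z' \<longleftrightarrow>
     holder_on \<alpha> {0..T} Z \<and> holder_on \<alpha> {0..T} Z' \<and>
     (\<exists>C. \<forall>s\<in>{0..T}. \<forall>t\<in>{0..T}.
        norm (Z t - Z s - Z' s *v (X t - X s)) \<le> C * \<bar>t - s\<bar> powr (2 * \<alpha>))"

section \<open>Piecewise linear interpolation and the interpolated equation\<close>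

definition partition_of :: "real \<Rightarrow> nat \<Rightarrow> (nat \<Rightarrow> real) \<Rightarrow> bool" where
  "partition_of T N t \<longleftrightarrow> t 0 = 0 \<and> t N = T \<and> (\<forall>n<N. t n < t (Suc n))"

definition pl_interp ::
    "nat \<Rightarrow> (nat \<Rightarrow> real) \<Rightarrow> (real \<Rightarrow> 'a::real_vector) \<Rightarrow> real \<Rightarrow> 'a" where
  "pl_interp N t Z r =
     (if r = t 0 then Z (t 0)
      else let n = (THE n. n < N \<and> t n < r \<and> r \<le> t (Suc n))
           in Z (t n) + ((r - t n) / (t (Suc n) - t n)) *\<^sub>R (Z (t (Suc n)) - Z (t n)))"

text \<open>Solutions of \<open>dY = \<Sum>\<^sub>a F\<^sub>a(Y) dV\<^sup>a\<close>, \<open>Y(t\<^sub>0) = y\<^sub>0\<close>, for a driver \<open>V\<close> that is differentiable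
  off the grid points: a continuous path satisfying the ODE on every open grid interval.\<close>

definition driven_solution ::
    "nat \<Rightarrow> (nat \<Rightarrow> real) \<Rightarrow> ('m::finite \<Rightarrow> 'e::real_normed_vector \<Rightarrow> 'e) \<Rightarrow> (real \<Rightarrow> real^'m)
      \<Rightarrow> 'e \<Rightarrow> (real \<Rightarrow> 'e) \<Rightarrow> bool" where
  "driven_solution N t F V y0 Y \<longleftrightarrow>
     continuous_on {t 0..t N} Y \<and> Y (t 0) = y0 \<and>
     (\<forall>n<N. \<forall>r\<in>{t n<..<t (Suc n)}.
        (Y has_vector_derivative (\<Sum>a\<in>UNIV. deriv (\<lambda>s. V s $ a) r *\<^sub>R F a (Y r))) (at r))"

lemma partition_of_mono:
  assumes "partition_of T N t" "i \<le> j" "j \<le> N"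
  shows "t i \<le> t j"
  using assms(2,3)
proof (induction j rule: dec_induct)
  case (step k)
  then have "t k < t (Suc k)" using assms(1) by (simp add: partition_of_def)
  with step show ?case by simp
qed simp

lemma pl_interp_eq:
  assumes P: "partition_of T N t" and n: "n < N" and r: "t n < r" "r \<le> t (Suc n)"
  shows "pl_interp N t Z r =
    Z (t n) + ((r - t n) / (t (Suc n) - t n)) *\<^sub>R (Z (t (Suc n)) - Z (t n))"
proof -
  have "(THE n. n < N \<and> t n < r \<and> r \<le> t (Suc n)) = n"
  proof (rule the_equality)
    fix k assume k: "k < N \<and> t k < r \<and> r \<le> t (Suc k)"
    show "k = n"
    proof (rule ccontr)
      assume "k \<noteq> n"
      then consider "Suc k \<le> n" | "Suc n \<le> k" by linarith
      then show False
      proof cases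
        case 1
        with partition_of_mono[OF P, of "Suc k" n] n k r show ?thesis by simp
      next
        case 2
        with partition_of_mono[OF P, of "Suc n" k] n k r show ?thesis by simp
      qed
    qed
  qed (use n r in simp)
  moreover have "r \<noteq> t 0"
    using partition_of_mono[OF P, of 0 n] n r by simp
  ultimately show ?thesis by (simp add: pl_interp_def)
qed

lemma deriv_pl_interp:
  fixes Z :: "real \<Rightarrow> real^'m"
  assumes P: "partition_of T N t" and n: "n < N" and r: "r \<in> {t n<..<t (Suc n)}"
  shows "deriv (\<lambda>s. pl_interp N t Z s $ a) r
         = (Z (t (Suc n)) $ a - Z (t n) $ a) / (t (Suc n) - t n)"
proof (rule DERIV_imp_deriv)
  let ?g = "\<lambda>s. Z (t n) $ a + ((s - t n) / (t (Suc n) - t n)) * (Z (t (Suc n)) $ a - Z (t n) $ a)"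
  have "(?g has_field_derivative (Z (t (Suc n)) $ a - Z (t n) $ a) / (t (Suc n) - t n)) (at r)"
    using r by (auto intro!: derivative_eq_intros)
  then show "((\<lambda>s. pl_interp N t Z s $ a) has_field_derivative
      (Z (t (Suc n)) $ a - Z (t n) $ a) / (t (Suc n) - t n)) (at r)"
  proof (rule DERIV_cong_ev[THEN iffD1, rotated 3])
    have "eventually (\<lambda>s. s \<in> {t n<..<t (Suc n)}) (nhds r)"
      using r by (intro eventually_nhds_in_open) auto
    then show "\<forall>\<^sub>F s in nhds r. ?g s = pl_interp N t Z s $ a"
      by eventually_elim (simp add: pl_interp_eq[OF P n])
  qed auto
qed

lemma driven_solution_pl_interp_iff:
  assumes "partition_of T N t"
  shows "driven_solution N t F (pl_interp N t Z) y0 Y \<longleftrightarrow>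
     continuous_on {0..T} Y \<and> Y 0 = y0 \<and>
     (\<forall>n<N. \<forall>r\<in>{t n<..<t (Suc n)}.
        (Y has_vector_derivative
          (\<Sum>a\<in>UNIV. ((Z (t (Suc n)) $ a - Z (t n) $ a) / (t (Suc n) - t n)) *\<^sub>R F a (Y r))) (at r))"
  using assms unfolding driven_solution_def
  by (simp add: deriv_pl_interp[OF assms] partition_of_def)

section \<open>The simplified controlled Runge-Kutta method\<close>

definition scrk_stages ::
    "real^'q^'q \<Rightarrow> ('m::finite \<Rightarrow> 'e::real_vector \<Rightarrow> 'e) \<Rightarrow> (real \<Rightarrow> real^'m)
      \<Rightarrow> real \<Rightarrow> real \<Rightarrow> 'e \<Rightarrow> ('q::finite \<Rightarrow> 'e) \<Rightarrow> bool" where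
  "scrk_stages A F Z u v y K \<longleftrightarrow>
     (\<forall>i. K i = y + (\<Sum>a\<in>UNIV. \<Sum>j\<in>UNIV. (A $ i $ j * (Z v $ a - Z u $ a)) *\<^sub>R F a (K j)))"

text \<open>\<open>S u v y i\<close> is the \<open>i\<close>-th stage \<open>Y\<^sub>i\<^sup>u\<^sup>,\<^sup>v(y)\<close>: for an implicit tableau the stage system may have
  several solutions, so the one-step map depends on the chosen solution \<open>S\<close>.\<close>

definition scrk_map ::
    "real^'q \<Rightarrow> ('m::finite \<Rightarrow> 'e::real_vector \<Rightarrow> 'e) \<Rightarrow> (real \<Rightarrow> real^'m)
      \<Rightarrow> (real \<Rightarrow> real \<Rightarrow> 'e \<Rightarrow> 'q::finite \<Rightarrow> 'e) \<Rightarrow> real \<Rightarrow> real \<Rightarrow> 'e \<Rightarrow> 'e" where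
  "scrk_map b F Z S u v y =
     y + (\<Sum>a\<in>UNIV. \<Sum>i\<in>UNIV. (b $ i * (Z v $ a - Z u $ a)) *\<^sub>R F a (S u v y i))"

section \<open>Decorated trees and elementary weights\<close>

text \<open>A nonempty nonplanar tree is a root decoration together with a multiset of nonempty subtrees,
  so that \<open>\<bullet>\<^sub>a\<close> is \<open>Node a {#}\<close>. The option type adjoins the empty tree, as \<open>None\<close>.\<close>

datatype 'a ntree = Node 'a "'a ntree multiset"

type_synonym 'a dtree = "'a ntree option"

primrec nvertices :: "'a ntree \<Rightarrow> nat" where
  "nvertices (Node a M) = Suc (\<Sum>\<^sub># (image_mset nvertices M))"

primrec nfactorial :: "'a ntree \<Rightarrow> nat" where
  "nfactorial (Node a M) = nvertices (Node a M) * \<Prod>\<^sub># (image_mset nfactorial M)"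

text \<open>Multiplication and \<open>1\<close> on \<open>real^'q\<close> are componentwise, so the products below are
  \<open>\<odot>\<close>-products, with the all-ones vector as empty product.\<close>

primrec nPhi :: "real^'q^'q \<Rightarrow> 'a ntree \<Rightarrow> real^'q" where
  "nPhi A (Node a M) = A *v \<Prod>\<^sub># (image_mset (nPhi A) M)"

fun na_hat :: "real^'q^'q \<Rightarrow> real^'q \<Rightarrow> 'a ntree \<Rightarrow> real" where
  "na_hat A b (Node a M) = b \<bullet> \<Prod>\<^sub># (image_mset (nPhi A) M)"

definition vertices :: "'a dtree \<Rightarrow> nat" where
  "vertices \<tau> = (case \<tau> of None \<Rightarrow> 0 | Some \<sigma> \<Rightarrow> nvertices \<sigma>)"

definition tree_factorial :: "'a dtree \<Rightarrow> nat" where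
  "tree_factorial \<tau> = (case \<tau> of None \<Rightarrow> 1 | Some \<sigma> \<Rightarrow> nfactorial \<sigma>)"

definition a_hat :: "real^'q^'q \<Rightarrow> real^'q \<Rightarrow> 'a dtree \<Rightarrow> real" where
  "a_hat A b \<tau> = (case \<tau> of None \<Rightarrow> 1 | Some \<sigma> \<Rightarrow> na_hat A b \<sigma>)"

definition trees_upto :: "nat \<Rightarrow> 'a dtree set" where
  "trees_upto p = {\<tau>. vertices \<tau> \<le> p}"

end

theory Submission
  imports Defs
begin

text \<open>Over one grid interval the driver is linear, so after rescaling time to \<open>[0,1]\<close> the exact
  solution solves \<open>Y' = \<Sum>\<^sub>a \<delta>\<^sub>a F\<^sub>a(Y)\<close> with the constant increment \<open>\<delta> = Z(t\<^sub>n\<^sub>+\<^sub>1) - Z(t\<^sub>n)\<close>, and the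
  scheme is an ordinary Runge-Kutta step of length one for the same vector field. By Hoelder
  continuity \<open>|\<delta>|\<close> is of order \<open>h\<^sub>n\<close> to the power \<open>\<alpha>\<close>, so it suffices to bound the one-step error by
  a multiple of \<open>|\<delta>|\<close> to the power \<open>p + 1\<close>, uniformly in the starting point and in \<open>\<delta>\<close>; the
  uniformity comes from the global bounds on the fields and their derivatives.

  The exact solution and the scheme are two instances of one fixed-point equation
  \<open>U = y + \<Sum>\<^sub>a \<delta>\<^sub>a I(F\<^sub>a \<circ> U)\<close> with a bounded linear operator \<open>I\<close>: for the flow \<open>I\<close> integrates from
  \<open>0\<close>, for the scheme it applies the matrix \<open>A\<close> to the stages and the row \<open>b\<close> to form the update.
  Putting the times in \<open>[0,1]\<close>, the stages and the update into a single index set makes it a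
  single equation, so that both objects are expanded simultaneously and with the same coefficients.

  Call \<open>U\<close> expandable to order \<open>k\<close> if it is a finite sum of terms \<open>c\<cdot>w(M)\<close> and a remainder
  of order \<open>|\<delta>|\<close> to the \<open>k\<close>. Here \<open>w(M)\<close> is the product of the elementary weights of the trees in a
  forest \<open>M\<close>, a function on the index set alone, and \<open>c\<close> is constant on the index set and of order
  \<open>|\<delta>|\<close> to the number of vertices of \<open>M\<close>. Such functions form an algebra; by Taylor's theorem they
  are stable under composition with \<open>k\<close> times differentiable functions; and \<open>\<delta>\<^sub>a I\<close> raises the order by one, because
  \<open>I\<close> applied to the weight of \<open>M\<close> is the weight of the tree obtained by grafting \<open>M\<close> onto a new root.
  Iterating the fixed-point equation therefore makes \<open>U - y\<close> expandable to order \<open>p + 1\<close>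
  (\<open>expandable_fixed_point\<close>), without any bookkeeping of symmetry factors.

  At time \<open>1\<close> the weight of a tree \<open>\<tau>\<close> is \<open>1/\<gamma>(\<tau>)\<close> (\<open>weight_time\<close>), and at the update it is
  the Runge-Kutta weight of \<open>\<tau>\<close> (\<open>weight_update\<close>). The order conditions say that these agree for
  trees with at most \<open>p\<close> vertices, hence also for forests of such trees, and all other terms are of
  order \<open>|\<delta>|\<close> to the \<open>p + 1\<close> (\<open>expandable_agree\<close>).\<close>

section \<open>Taylor expansion for functions with bounded derivatives\<close>

lemma C_b_bounded: "C_b k f \<Longrightarrow> bounded (range f)"
  by (cases k) auto

lemma C_b_frechet_derivative: "C_b (Suc k) f \<Longrightarrow> C_b k (\<lambda>x. frechet_derivative f (at x) v)"
  by simp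

lemma C_b_differentiable: "C_b (Suc k) f \<Longrightarrow> f differentiable (at x)"
  by simp

lemma C_b_Suc_imp: "C_b (Suc k) f \<Longrightarrow> C_b k f"
proof (induction k arbitrary: f)
  case 0
  then show ?case
    by (auto simp: differentiable_imp_continuous_within continuous_on_eq_continuous_at)
next
  case (Suc k)
  have "C_b k (\<lambda>x. frechet_derivative f (at x) v)" for v
    by (rule Suc.IH[OF C_b_frechet_derivative[OF Suc.prems]])
  then show ?case
    using C_b_bounded[OF Suc.prems] C_b_differentiable[OF Suc.prems] by simp
qed

lemma C_b_antimono: "C_b l f \<Longrightarrow> k \<le> l \<Longrightarrow> C_b k f"
  by (induction l) (auto simp: le_Suc_eq dest: C_b_Suc_imp simp del: C_b.simps)

lemma C_b_continuous: "C_b k f \<Longrightarrow> continuous_on UNIV f"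
  using C_b_antimono[of k f 0] by simp

lemma C_b_bounded_linear:
  assumes "bounded_linear L" "C_b k f"
  shows "C_b k (\<lambda>x. L (f x))"
  using assms(2)
proof (induction k arbitrary: f)
  case 0
  then show ?case
    using bounded_linear_image[OF _ assms(1), of "range f"]
    by (auto simp: image_image intro!: bounded_linear.continuous_on[OF assms(1)])
next
  case (Suc k)
  have der: "((\<lambda>x. L (f x)) has_derivative (\<lambda>v. L (frechet_derivative f (at x) v))) (at x)" for x
    using Suc.prems
    by (intro bounded_linear.has_derivative[OF assms(1)])
      (auto simp: frechet_derivative_works[symmetric])
  then have "frechet_derivative (\<lambda>x. L (f x)) (at x) v = L (frechet_derivative f (at x) v)" for x v
    using frechet_derivative_at[OF der] by metis
  moreover have "bounded (range (\<lambda>x. L (f x)))"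
    using Suc.prems bounded_linear_image[OF _ assms(1), of "range f"] by (auto simp: image_image)
  moreover have "(\<lambda>x. L (f x)) differentiable (at x)" for x
    using der differentiableI by blast
  ultimately show ?case
    using Suc by simp
qed

primrec iterated_dderiv :: "nat \<Rightarrow> 'a::euclidean_space \<Rightarrow> ('a \<Rightarrow> real) \<Rightarrow> 'a \<Rightarrow> real" where
  "iterated_dderiv 0 u f = f"
| "iterated_dderiv (Suc m) u f = iterated_dderiv m u (\<lambda>x. frechet_derivative f (at x) u)"

lemma iterated_dderiv_sum:
  assumes "finite B" "\<And>i. i \<in> B \<Longrightarrow> C_b m (g i)"
  shows "iterated_dderiv m u (\<lambda>x. \<Sum>i\<in>B. c i * g i x) = (\<lambda>x. \<Sum>i\<in>B. c i * iterated_dderiv m u (g i) x)"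
  using assms(2)
proof (induction m arbitrary: g)
  case (Suc m)
  have der: "((\<lambda>x. \<Sum>i\<in>B. c i * g i x) has_derivative
      (\<lambda>v. \<Sum>i\<in>B. c i * frechet_derivative (g i) (at x) v)) (at x)" for x
    using Suc.prems
    by (intro has_derivative_sum has_derivative_mult_right) (auto simp: frechet_derivative_works[symmetric])
  have *: "frechet_derivative (\<lambda>x. \<Sum>i\<in>B. c i * g i x) (at x) u =
      (\<Sum>i\<in>B. c i * frechet_derivative (g i) (at x) u)" for x
    using fun_cong[OF frechet_derivative_at[OF der[of x]], of u] by simp
  show ?case
    using Suc by (simp add: *)
qed simp

text \<open>Peeling off one derivative and writing its direction in the basis shows that the iterated
  derivative is a homogeneous polynomial in the direction, with coefficients depending on the base
  point. Bounds and expansions of iterated derivatives are obtained by induction along this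
  recursion.\<close>

lemma iterated_dderiv_Suc_Basis:
  assumes "C_b (Suc m) f"
  shows "iterated_dderiv (Suc m) u f x =
    (\<Sum>i\<in>Basis. (u \<bullet> i) * iterated_dderiv m u (\<lambda>x. frechet_derivative f (at x) i) x)"
proof -
  have "frechet_derivative f (at x) u = (\<Sum>i\<in>Basis. (u \<bullet> i) * frechet_derivative f (at x) i)" for x
  proof -
    have "linear (frechet_derivative f (at x))"
      using assms by (auto intro: linear_frechet_derivative)
    then have "frechet_derivative f (at x) (\<Sum>i\<in>Basis. (u \<bullet> i) *\<^sub>R i) =
        (\<Sum>i\<in>Basis. (u \<bullet> i) * frechet_derivative f (at x) i)"
      by (simp add: linear_sum linear_scale)
    then show ?thesis by (simp add: euclidean_representation)
  qed
  then show ?thesis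
    using assms by (simp add: iterated_dderiv_sum)
qed

lemma iterated_dderiv_bound:
  assumes "C_b m f"
  shows "\<exists>C. \<forall>u x. \<bar>iterated_dderiv m u f x\<bar> \<le> C * norm u ^ m"
  using assms
proof (induction m arbitrary: f)
  case 0
  then show ?case by (auto simp: bounded_iff)
next
  case (Suc m)
  have "\<forall>i. \<exists>C. \<forall>u x. \<bar>iterated_dderiv m u (\<lambda>x. frechet_derivative f (at x) i) x\<bar> \<le> C * norm u ^ m"
    using Suc by auto
  then obtain C where C: "\<And>i u x. \<bar>iterated_dderiv m u (\<lambda>x. frechet_derivative f (at x) i) x\<bar> \<le> C i * norm u ^ m"
    by metis
  have "\<bar>iterated_dderiv (Suc m) u f x\<bar> \<le> (\<Sum>i\<in>Basis. C i) * norm u ^ Suc m" for u x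
  proof -
    have "\<bar>iterated_dderiv (Suc m) u f x\<bar>
        \<le> (\<Sum>i\<in>Basis. \<bar>u \<bullet> i\<bar> * \<bar>iterated_dderiv m u (\<lambda>x. frechet_derivative f (at x) i) x\<bar>)"
      unfolding iterated_dderiv_Suc_Basis[OF Suc.prems] abs_mult[symmetric] by (rule sum_abs)
    also have "\<dots> \<le> (\<Sum>i\<in>Basis. norm u * (C i * norm u ^ m))"
      by (intro sum_mono mult_mono C) (auto simp: Basis_le_norm)
    finally show ?thesis by (simp add: sum_distrib_left sum_distrib_right mult_ac)
  qed
  then show ?case by blast
qed

lemma DERIV_iterated_dderiv:
  assumes "C_b (Suc m) f"
  shows "((\<lambda>\<theta>. iterated_dderiv m u f (y + \<theta> *\<^sub>R u)) has_real_derivative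
    iterated_dderiv (Suc m) u f (y + \<theta> *\<^sub>R u)) (at \<theta>)"
  using assms
proof (induction m arbitrary: f)
  case 0
  have "(f has_derivative frechet_derivative f (at (y + \<theta> *\<^sub>R u))) (at (y + \<theta> *\<^sub>R u))"
    using 0 by (simp add: frechet_derivative_works[symmetric])
  then have "((\<lambda>\<theta>. f (y + \<theta> *\<^sub>R u)) has_derivative
      (\<lambda>h. frechet_derivative f (at (y + \<theta> *\<^sub>R u)) (h *\<^sub>R u))) (at \<theta>)"
    by (rule has_derivative_compose[rotated]) (auto intro!: derivative_eq_intros)
  moreover have "linear (frechet_derivative f (at (y + \<theta> *\<^sub>R u)))"
    using 0 by (auto intro: linear_frechet_derivative)
  ultimately show ?case
    by (simp add: has_field_derivative_def linear_scale mult_commute_abs)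
next
  case (Suc m)
  from Suc.IH[OF C_b_frechet_derivative[OF Suc.prems]] show ?case by simp
qed

text \<open>The one-dimensional Taylor formula on the segment from \<open>y\<close> to \<open>y + u\<close>. The remainder is
  uniform in \<open>y\<close> and \<open>u\<close> as derivatives are bounded globally.\<close>

lemma C_b_Taylor:
  assumes "C_b k f"
  shows "\<exists>C. \<forall>y u. \<bar>f (y + u) - (\<Sum>m<k. iterated_dderiv m u f y / fact m)\<bar> \<le> C * norm u ^ k"
proof (cases "k = 0")
  case True
  then show ?thesis using assms by (auto simp: bounded_iff)
next
  case False
  obtain C where C: "\<And>u x. \<bar>iterated_dderiv k u f x\<bar> \<le> C * norm u ^ k"
    using iterated_dderiv_bound[OF assms] by blast
  have "\<bar>f (y + u) - (\<Sum>m<k. iterated_dderiv m u f y / fact m)\<bar> \<le> C / fact k * norm u ^ k" for y u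
  proof -
    define diff where "diff m \<theta> = iterated_dderiv m u f (y + \<theta> *\<^sub>R u)" for m \<theta>
    have "\<forall>m \<theta>. m < k \<and> 0 \<le> \<theta> \<and> \<theta> \<le> 1 \<longrightarrow> DERIV (diff m) \<theta> :> diff (Suc m) \<theta>"
    proof clarify
      fix m and \<theta> :: real assume "m < k"
      then have "C_b (Suc m) f" using C_b_antimono[OF assms, of "Suc m"] by linarith
      then show "DERIV (diff m) \<theta> :> diff (Suc m) \<theta>"
        unfolding diff_def[abs_def] by (rule DERIV_iterated_dderiv)
    qed
    with False obtain \<theta> where
      "diff 0 1 = (\<Sum>m<k. diff m 0 / fact m * 1 ^ m) + diff k \<theta> / fact k * 1 ^ k"
      using Maclaurin[of 1 k diff "diff 0"] by auto
    then have "f (y + u) - (\<Sum>m<k. iterated_dderiv m u f y / fact m)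
        = iterated_dderiv k u f (y + \<theta> *\<^sub>R u) / fact k"
      by (simp add: diff_def)
    then show ?thesis
      using C by (simp add: divide_right_mono)
  qed
  then show ?thesis by blast
qed

section \<open>The exact flow and the scheme as one fixed-point equation\<close>

text \<open>\<open>Inl s\<close> is the time \<open>s\<close> of the exact flow, \<open>Inr (Some i)\<close> the \<open>i\<close>-th stage of the scheme, and
  \<open>Inr None\<close> its update, treated as one more stage on which no other stage depends.\<close>

type_synonym 'q stage_index = "real + 'q option"

definition stage_indices :: "'q stage_index set" where
  "stage_indices = Inl ` {0..1} \<union> range Inr"

definition admissible :: "('q stage_index \<Rightarrow> real) \<Rightarrow> bool" where
  "admissible u \<longleftrightarrow> continuous_on {0..1} (\<lambda>s. u (Inl s))"

text \<open>The Picard operator of the combined fixed-point equation. Over the real indices it is the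
  indefinite integral, over the others multiplication by the tableau with \<open>b\<close> as an additional row.\<close>

definition stage_op ::
    "real^'q^'q \<Rightarrow> real^'q \<Rightarrow> ('q::finite stage_index \<Rightarrow> real) \<Rightarrow> 'q stage_index \<Rightarrow> real" where
  "stage_op A b u x = (case x of
     Inl s \<Rightarrow> integral {0..s} (\<lambda>r. u (Inl r))
   | Inr None \<Rightarrow> (\<Sum>j\<in>UNIV. b $ j * u (Inr (Some j)))
   | Inr (Some i) \<Rightarrow> (\<Sum>j\<in>UNIV. A $ i $ j * u (Inr (Some j))))"

lemma stage_index_cases:
  assumes "x \<in> stage_indices"
  obtains (time) s where "x = Inl s" "0 \<le> s" "s \<le> 1"
  | (update) "x = Inr None"
  | (stage) i where "x = Inr (Some i)"
  using assms by (auto simp: stage_indices_def) (metis not_None_eq)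

lemma Inl_mem_stage_indices [simp]: "Inl s \<in> stage_indices \<longleftrightarrow> 0 \<le> s \<and> s \<le> 1"
  and Inr_mem_stage_indices [simp]: "Inr o' \<in> stage_indices"
  by (auto simp: stage_indices_def)

lemma admissible_const: "admissible (\<lambda>x. c)"
  and admissible_add: "admissible u \<Longrightarrow> admissible v \<Longrightarrow> admissible (\<lambda>x. u x + v x)"
  and admissible_diff: "admissible u \<Longrightarrow> admissible v \<Longrightarrow> admissible (\<lambda>x. u x - v x)"
  and admissible_mult: "admissible u \<Longrightarrow> admissible v \<Longrightarrow> admissible (\<lambda>x. u x * v x)"
  by (auto simp: admissible_def intro!: continuous_intros)

lemma admissible_cong:
  "(\<And>x. x \<in> stage_indices \<Longrightarrow> u x = v x) \<Longrightarrow> admissible u \<longleftrightarrow> admissible v"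
  unfolding admissible_def by (rule continuous_on_cong) auto

lemma admissible_bounded:
  fixes u :: "'q::finite stage_index \<Rightarrow> real"
  assumes "admissible u"
  shows "\<exists>B. \<forall>x\<in>stage_indices. \<bar>u x\<bar> \<le> B"
proof -
  have "compact ((\<lambda>s. u (Inl s)) ` {0..1})"
    using assms by (intro compact_continuous_image) (auto simp: admissible_def)
  then have "bounded ((\<lambda>s. u (Inl s)) ` {0..1} \<union> range (\<lambda>j. u (Inr j)))"
    by (auto simp: compact_imp_bounded finite_imp_bounded)
  then show ?thesis
    by (auto simp: stage_indices_def bounded_iff)
qed

lemma stage_op_add:
  assumes "admissible u" "admissible v" "x \<in> stage_indices"
  shows "stage_op A b (\<lambda>x. u x + v x) x = stage_op A b u x + stage_op A b v x"
  using assms(3)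
proof (cases rule: stage_index_cases)
  case (time s)
  have "(\<lambda>r. u (Inl r)) integrable_on {0..s}" "(\<lambda>r. v (Inl r)) integrable_on {0..s}"
    using assms time
    by (auto simp: admissible_def intro!: integrable_continuous_interval elim: continuous_on_subset)
  then show ?thesis by (simp add: stage_op_def time Henstock_Kurzweil_Integration.integral_add)
qed (auto simp: stage_op_def sum.distrib algebra_simps)

lemma stage_op_scale: "stage_op A b (\<lambda>x. c * u x) x = c * stage_op A b u x"
  by (auto simp: stage_op_def sum_distrib_left mult_ac split: sum.splits option.splits)

lemma admissible_stage_op: "admissible u \<Longrightarrow> admissible (stage_op A b u)"
  unfolding admissible_def stage_op_def
  by (auto intro!: indefinite_integral_continuous_1 integrable_continuous_interval)

lemma stage_op_bound:
  fixes A :: "real^'q^'q" and b :: "real^'q"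
  obtains K where "K \<ge> 0" "\<And>u B x. admissible u \<Longrightarrow> (\<And>z. z \<in> stage_indices \<Longrightarrow> \<bar>u z\<bar> \<le> B) \<Longrightarrow>
    x \<in> stage_indices \<Longrightarrow> \<bar>stage_op A b u x\<bar> \<le> K * B"
proof
  let ?K = "1 + (\<Sum>j\<in>UNIV. \<bar>b $ j\<bar>) + (\<Sum>i\<in>UNIV. \<Sum>j\<in>UNIV. \<bar>A $ i $ j\<bar>)"
  show "?K \<ge> 0" by (auto intro!: add_nonneg_nonneg sum_nonneg)
  fix u :: "'q stage_index \<Rightarrow> real" and B :: real and x :: "'q stage_index"
  assume u: "admissible u" and B: "\<And>z. z \<in> stage_indices \<Longrightarrow> \<bar>u z\<bar> \<le> B" and x: "x \<in> stage_indices"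
  have B0: "B \<ge> 0" using B[of "Inr None"] by simp
  have sums: "\<bar>\<Sum>j\<in>UNIV. c j * u (Inr (Some j))\<bar> \<le> (\<Sum>j\<in>UNIV. \<bar>c j\<bar>) * B" for c
    unfolding sum_distrib_right
    by (rule order_trans[OF sum_abs]) (auto intro!: sum_mono mult_left_mono B simp: abs_mult)
  from x show "\<bar>stage_op A b u x\<bar> \<le> ?K * B"
  proof (cases rule: stage_index_cases)
    case (time s)
    have "norm (integral {0..s} (\<lambda>r. u (Inl r))) \<le> B * (s - 0)"
      using time u
      by (intro integral_bound) (auto simp: admissible_def intro!: B elim: continuous_on_subset)
    also have "\<dots> \<le> 1 * B" using time B0 by (simp add: mult_left_le)
    also have "\<dots> \<le> ?K * B"
      by (intro mult_right_mono B0) (auto intro!: add_nonneg_nonneg sum_nonneg)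
    finally show ?thesis by (simp add: stage_op_def time)
  next
    case update
    then have "\<bar>stage_op A b u x\<bar> \<le> (\<Sum>j\<in>UNIV. \<bar>b $ j\<bar>) * B"
      using sums[of "\<lambda>j. b $ j"] by (simp add: stage_op_def)
    also have "\<dots> \<le> ?K * B"
      by (intro mult_right_mono B0) (auto intro!: add_nonneg_nonneg sum_nonneg)
    finally show ?thesis .
  next
    case (stage i)
    then have "\<bar>stage_op A b u x\<bar> \<le> (\<Sum>j\<in>UNIV. \<bar>A $ i $ j\<bar>) * B"
      using sums[of "\<lambda>j. A $ i $ j"] by (simp add: stage_op_def)
    also have "\<dots> \<le> (\<Sum>i\<in>UNIV. \<Sum>j\<in>UNIV. \<bar>A $ i $ j\<bar>) * B"
      by (intro mult_right_mono B0 member_le_sum) (auto intro!: sum_nonneg)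
    also have "\<dots> \<le> ?K * B"
      by (intro mult_right_mono B0) (auto intro!: add_nonneg_nonneg sum_nonneg)
    finally show ?thesis .
  qed
qed

section \<open>Elementary weights of trees and forests\<close>

primrec weight ::
    "real^'q^'q \<Rightarrow> real^'q \<Rightarrow> 'a ntree \<Rightarrow> 'q::finite stage_index \<Rightarrow> real" where
  "weight A b (Node a M) =
     stage_op A b (\<lambda>x. \<Prod>\<^sub># (image_mset (\<lambda>w. w x) (image_mset (weight A b) M)))"

definition forest_weight ::
    "real^'q^'q \<Rightarrow> real^'q \<Rightarrow> 'a ntree multiset \<Rightarrow> 'q::finite stage_index \<Rightarrow> real" where
  "forest_weight A b M x = \<Prod>\<^sub># (image_mset (\<lambda>\<tau>. weight A b \<tau> x) M)"

definition forest_size :: "'a ntree multiset \<Rightarrow> nat" where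
  "forest_size M = \<Sum>\<^sub># (image_mset nvertices M)"

text \<open>The rule that makes trees appear: applying the Picard operator to the weight of a forest
  grafts the forest onto a new root.\<close>

lemma weight_Node: "weight A b (Node a M) = stage_op A b (forest_weight A b M)"
  by (simp add: forest_weight_def[abs_def] multiset.map_comp o_def)

declare weight.simps [simp del]

lemma forest_weight_empty [simp]: "forest_weight A b {#} x = 1"
  and forest_weight_add_mset [simp]:
    "forest_weight A b (add_mset \<tau> M) x = weight A b \<tau> x * forest_weight A b M x"
  and forest_weight_union:
    "forest_weight A b (M + M') x = forest_weight A b M x * forest_weight A b M' x"
  and forest_size_empty [simp]: "forest_size {#} = 0"
  and forest_size_add_mset [simp]: "forest_size (add_mset \<tau> M) = nvertices \<tau> + forest_size M"
  and forest_size_union: "forest_size (M + M') = forest_size M + forest_size M'"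
  by (simp_all add: forest_weight_def forest_size_def)

lemma nvertices_Node: "nvertices (Node a M) = Suc (forest_size M)"
  by (simp add: forest_size_def)

lemma admissible_forest_weight_if:
  assumes "\<And>\<tau>. \<tau> \<in># M \<Longrightarrow> admissible (weight A b \<tau>)"
  shows "admissible (forest_weight A b M)"
  using assms
proof (induction M)
  case empty
  have "forest_weight A b {#} = (\<lambda>x. 1)" by (simp add: fun_eq_iff)
  then show ?case by (simp add: admissible_const)
next
  case (add \<tau> M)
  have "forest_weight A b (add_mset \<tau> M) = (\<lambda>x. weight A b \<tau> x * forest_weight A b M x)"
    by (simp add: fun_eq_iff)
  then show ?case using add by (simp add: admissible_mult)
qed

lemma admissible_weight: "admissible (weight A b \<tau>)"
proof (induction \<tau>)
  case (Node a M)
  then show ?case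
    unfolding weight_Node by (intro admissible_stage_op admissible_forest_weight_if)
qed

lemma admissible_forest_weight: "admissible (forest_weight A b M)"
  by (intro admissible_forest_weight_if admissible_weight)

lemma prod_mset_vec_nth: "(\<Prod>\<^sub># M) $ i = \<Prod>\<^sub># (image_mset (\<lambda>v. v $ i) M)"
  for M :: "(real^'q) multiset"
  by (induction M) auto

lemma weight_stage: "weight A b \<tau> (Inr (Some i)) = nPhi A \<tau> $ i"
proof (induction \<tau> arbitrary: i)
  case (Node a M)
  have "(\<Prod>\<^sub># (image_mset (nPhi A) M)) $ j = forest_weight A b M (Inr (Some j))" for j
    using Node by (auto simp: prod_mset_vec_nth forest_weight_def multiset.map_comp o_def
        intro!: arg_cong[of _ _ prod_mset] image_mset_cong)
  then show ?case
    by (simp add: weight_Node stage_op_def matrix_vector_mult_def)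
qed

lemma weight_update: "weight A b \<tau> (Inr None) = na_hat A b \<tau>"
proof (cases \<tau>)
  case (Node a M)
  have "(\<Prod>\<^sub># (image_mset (nPhi A) M)) $ j = forest_weight A b M (Inr (Some j))" for j
    by (simp add: prod_mset_vec_nth forest_weight_def multiset.map_comp o_def weight_stage)
  then show ?thesis
    by (simp add: Node weight_Node stage_op_def inner_vec_def)
qed

text \<open>On the times the weight is the iterated integral indexed by the tree; each root
  contributes the factor \<open>1/|\<tau>|\<close> from integrating a power of degree \<open>|\<tau>| - 1\<close>, which is the
  recursion of the tree factorial.\<close>

lemma weight_time:
  "0 \<le> s \<Longrightarrow> weight A b \<tau> (Inl s) = s ^ nvertices \<tau> / real (nfactorial \<tau>)"
proof (induction \<tau> arbitrary: s)
  case (Node a M)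
  define P where "P = real (\<Prod>\<^sub># (image_mset nfactorial M))"
  have forest: "forest_weight A b M (Inl r) = r ^ forest_size M / P" if "0 \<le> r" for r
    using Node.IH that unfolding P_def by (induction M) (auto simp: power_add)
  have "((\<lambda>r. r ^ Suc (forest_size M) / real (Suc (forest_size M))) has_real_derivative
      r ^ forest_size M) (at r within {0..s})" for r
    using DERIV_cdivide[OF DERIV_pow[of "Suc (forest_size M)" r "{0..s}"], of "real (Suc (forest_size M))"]
    by (simp del: power_Suc of_nat_Suc)
  then have "((\<lambda>r. r ^ forest_size M) has_integral
      s ^ Suc (forest_size M) / Suc (forest_size M) - 0 ^ Suc (forest_size M) / Suc (forest_size M)) {0..s}"
    using Node.prems
    by (intro fundamental_theorem_of_calculus) (simp_all flip: has_real_derivative_iff_has_vector_derivative)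
  then have "((\<lambda>r. r ^ forest_size M) has_integral s ^ Suc (forest_size M) / Suc (forest_size M)) {0..s}"
    by (simp del: of_nat_Suc)
  then have "((\<lambda>r. r ^ forest_size M / P) has_integral
      (s ^ Suc (forest_size M) / Suc (forest_size M)) / P) {0..s}"
    by (rule has_integral_divide)
  then have "((\<lambda>r. forest_weight A b M (Inl r)) has_integral
      (s ^ Suc (forest_size M) / Suc (forest_size M)) / P) {0..s}"
    by (rule has_integral_eq[rotated]) (simp add: forest)
  from integral_unique[OF this] show ?case
    by (simp only: weight_Node stage_op_def sum.case nvertices_Node nfactorial.simps of_nat_mult
        P_def divide_divide_eq_left)
qed

section \<open>Functions with a tree expansion\<close>

text \<open>An element of \<open>\<Omega>\<close> is a scenario, here a starting point, an increment and a solution; all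
  constants below have to be uniform in it. The bound \<open>E\<close> on the increments makes higher powers
  of \<open>|\<delta>|\<close> dominated by lower ones.\<close>

locale increment_family =
  fixes A :: "real^'q^'q" and b :: "real^'q"
    and \<Omega> :: "'w set" and \<delta> :: "'w \<Rightarrow> real^'m" and E :: real
  assumes increment_bound: "\<omega> \<in> \<Omega> \<Longrightarrow> norm (\<delta> \<omega>) \<le> E"
begin

text \<open>In the first rule the coefficient depends on the scenario only and the weight on the index
  only; this separation is what allows the flow and the scheme to be compared term by term.
  Forests with \<open>k\<close> or more vertices are permitted too, so that products need no truncation.
  The remainder is required to be admissible because the Picard operator is additive on
  admissible functions.\<close>

inductive expandable :: "nat \<Rightarrow> ('w \<Rightarrow> 'q stage_index \<Rightarrow> real) \<Rightarrow> bool" for k where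
  weight: "\<forall>\<omega>\<in>\<Omega>. \<bar>c \<omega>\<bar> \<le> C * norm (\<delta> \<omega>) ^ forest_size M \<Longrightarrow>
    expandable k (\<lambda>\<omega> x. c \<omega> * forest_weight A b (M :: 'm ntree multiset) x)"
| remainder: "\<forall>\<omega>\<in>\<Omega>. admissible (r \<omega>) \<and> (\<forall>x\<in>stage_indices. \<bar>r \<omega> x\<bar> \<le> C * norm (\<delta> \<omega>) ^ k) \<Longrightarrow>
    expandable k r"
| add: "expandable k u \<Longrightarrow> expandable k v \<Longrightarrow> expandable k (\<lambda>\<omega> x. u \<omega> x + v \<omega> x)"

lemma increment_power_bound: "\<omega> \<in> \<Omega> \<Longrightarrow> norm (\<delta> \<omega>) ^ n \<le> E ^ n"
  by (intro power_mono increment_bound) auto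

lemma increment_power_antimono:
  assumes "\<omega> \<in> \<Omega>" "k \<le> n"
  shows "norm (\<delta> \<omega>) ^ n \<le> E ^ (n - k) * norm (\<delta> \<omega>) ^ k"
proof -
  have "norm (\<delta> \<omega>) ^ n = norm (\<delta> \<omega>) ^ (n - k) * norm (\<delta> \<omega>) ^ k"
    using assms by (simp flip: power_add)
  also have "\<dots> \<le> E ^ (n - k) * norm (\<delta> \<omega>) ^ k"
    using assms by (intro mult_right_mono increment_power_bound) auto
  finally show ?thesis .
qed

lemma expandable_admissible:
  assumes "expandable k u" "\<omega> \<in> \<Omega>"
  shows "admissible (u \<omega>)"
  using assms
  by induction (auto intro!: admissible_mult admissible_const admissible_forest_weight admissible_add)

lemma expandable_cong:
  assumes "expandable k u" "\<And>\<omega> x. \<omega> \<in> \<Omega> \<Longrightarrow> x \<in> stage_indices \<Longrightarrow> v \<omega> x = u \<omega> x"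
  shows "expandable k v"
proof -
  have "admissible (\<lambda>x. v \<omega> x - u \<omega> x)" if "\<omega> \<in> \<Omega>" for \<omega>
    using assms(2) that admissible_cong[of "\<lambda>x. v \<omega> x - u \<omega> x" "\<lambda>x. 0"] admissible_const by simp
  then have "expandable k (\<lambda>\<omega> x. v \<omega> x - u \<omega> x)"
    using assms(2) by (intro remainder[where C = 0]) auto
  from add[OF assms(1) this] show ?thesis by simp
qed

lemma expandable_const:
  assumes "\<And>\<omega>. \<omega> \<in> \<Omega> \<Longrightarrow> \<bar>c \<omega>\<bar> \<le> C"
  shows "expandable k (\<lambda>\<omega> x. c \<omega>)"
  using weight[of c C "{#}" k] assms by simp

lemma expandable_bounded:
  assumes "expandable k u"
  shows "\<exists>B. \<forall>\<omega>\<in>\<Omega>. \<forall>x\<in>stage_indices. \<bar>u \<omega> x\<bar> \<le> B"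
  using assms
proof induction
  case (weight c C M)
  obtain B where B: "\<bar>forest_weight A b M x\<bar> \<le> B" if "x \<in> stage_indices" for x
    using admissible_bounded[OF admissible_forest_weight] by blast
  have "\<bar>c \<omega> * forest_weight A b M x\<bar> \<le> \<bar>C\<bar> * E ^ forest_size M * B"
    if "\<omega> \<in> \<Omega>" "x \<in> stage_indices" for \<omega> x
  proof -
    have "\<bar>c \<omega>\<bar> \<le> \<bar>C\<bar> * norm (\<delta> \<omega>) ^ forest_size M"
      using weight that by (meson abs_ge_self mult_right_mono norm_ge_zero order_trans zero_le_power)
    also have "\<dots> \<le> \<bar>C\<bar> * E ^ forest_size M"
      using that by (intro mult_left_mono increment_power_bound) auto
    finally show ?thesis
      using B that unfolding abs_mult by (intro mult_mono) (auto intro: order_trans[OF abs_ge_zero])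
  qed
  then show ?case by blast
next
  case (remainder r C)
  have "\<bar>r \<omega> x\<bar> \<le> \<bar>C\<bar> * E ^ k" if "\<omega> \<in> \<Omega>" "x \<in> stage_indices" for \<omega> x
  proof -
    have "\<bar>r \<omega> x\<bar> \<le> C * norm (\<delta> \<omega>) ^ k" using remainder that by blast
    also have "\<dots> \<le> \<bar>C\<bar> * E ^ k"
      using that by (intro mult_mono increment_power_bound) auto
    finally show ?thesis .
  qed
  then show ?case by blast
next
  case (add u v)
  then obtain B B' where "\<forall>\<omega>\<in>\<Omega>. \<forall>x\<in>stage_indices. \<bar>u \<omega> x\<bar> \<le> B"
    "\<forall>\<omega>\<in>\<Omega>. \<forall>x\<in>stage_indices. \<bar>v \<omega> x\<bar> \<le> B'"
    by blast
  then have "\<forall>\<omega>\<in>\<Omega>. \<forall>x\<in>stage_indices. \<bar>u \<omega> x + v \<omega> x\<bar> \<le> B + B'"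
    by (meson abs_triangle_ineq add_mono order_trans)
  then show ?case by blast
qed

lemma expandable_remainder_mult:
  assumes "\<forall>\<omega>\<in>\<Omega>. admissible (r \<omega>) \<and> (\<forall>x\<in>stage_indices. \<bar>r \<omega> x\<bar> \<le> C * norm (\<delta> \<omega>) ^ k)"
    and "expandable k v"
  shows "expandable k (\<lambda>\<omega> x. r \<omega> x * v \<omega> x)"
proof -
  obtain B where B: "\<And>\<omega> x. \<omega> \<in> \<Omega> \<Longrightarrow> x \<in> stage_indices \<Longrightarrow> \<bar>v \<omega> x\<bar> \<le> B"
    using expandable_bounded[OF assms(2)] by blast
  have "\<bar>r \<omega> x * v \<omega> x\<bar> \<le> C * B * norm (\<delta> \<omega>) ^ k" if "\<omega> \<in> \<Omega>" "x \<in> stage_indices" for \<omega> x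
  proof -
    have r: "\<bar>r \<omega> x\<bar> \<le> C * norm (\<delta> \<omega>) ^ k" using assms that by blast
    then have "\<bar>r \<omega> x * v \<omega> x\<bar> \<le> (C * norm (\<delta> \<omega>) ^ k) * B"
      unfolding abs_mult using B[OF that] by (intro mult_mono) (auto intro: order_trans[OF abs_ge_zero])
    then show ?thesis by (simp add: mult_ac)
  qed
  then show ?thesis
    using assms expandable_admissible[OF assms(2)]
    by (intro remainder[where C = "C * B"]) (auto intro: admissible_mult)
qed

lemma expandable_mult:
  assumes "expandable k u" "expandable k v"
  shows "expandable k (\<lambda>\<omega> x. u \<omega> x * v \<omega> x)"
  using assms(1)
proof induction
  case (weight c C M)
  note u = weight
  show ?case
    using assms(2)
  proof induction
    case (weight c' C' M')
    have "\<bar>c \<omega> * c' \<omega>\<bar> \<le> (C * C') * norm (\<delta> \<omega>) ^ forest_size (M + M')" if "\<omega> \<in> \<Omega>" for \<omega>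
    proof -
      have "\<bar>c \<omega> * c' \<omega>\<bar> \<le> (C * norm (\<delta> \<omega>) ^ forest_size M) * (C' * norm (\<delta> \<omega>) ^ forest_size M')"
        unfolding abs_mult using u weight that
        by (intro mult_mono) (auto intro: order_trans[OF abs_ge_zero])
      then show ?thesis by (simp add: forest_size_union power_add mult_ac)
    qed
    then have "expandable k (\<lambda>\<omega> x. (c \<omega> * c' \<omega>) * forest_weight A b (M + M') x)"
      by (intro expandable.weight) blast
    then show ?case
      by (rule expandable_cong) (simp add: forest_weight_union)
  next
    case (remainder r C')
    have "expandable k (\<lambda>\<omega> x. r \<omega> x * (c \<omega> * forest_weight A b M x))"
      using remainder expandable.weight[OF u] by (rule expandable_remainder_mult)
    then show ?case by (simp add: mult_ac)
  next
    case (add v w)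
    then show ?case
      by (auto intro: expandable.add simp: distrib_left)
  qed
next
  case (remainder r C)
  then show ?case using assms(2) by (rule expandable_remainder_mult)
next
  case (add u w)
  then show ?case
    by (auto intro: expandable.add simp: distrib_right)
qed

lemma expandable_sum:
  assumes "finite J" "\<And>j. j \<in> J \<Longrightarrow> expandable k (u j)"
  shows "expandable k (\<lambda>\<omega> x. \<Sum>j\<in>J. u j \<omega> x)"
  using assms
  by (induction J) (auto intro: add expandable_const[of "\<lambda>\<omega>. 0" 0])

text \<open>One Picard step gains one order: the increment contributes a factor \<open>|\<delta>|\<close>, which pays for the
  new root of the grafted tree and for the improved remainder.\<close>

lemma expandable_stage_op:
  assumes "expandable k u"
  shows "expandable (Suc k) (\<lambda>\<omega> x. \<delta> \<omega> $ a * stage_op A b (u \<omega>) x)"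
  using assms
proof induction
  case (weight c C M)
  have "\<bar>\<delta> \<omega> $ a * c \<omega>\<bar> \<le> C * norm (\<delta> \<omega>) ^ forest_size {#Node a M#}" if "\<omega> \<in> \<Omega>" for \<omega>
  proof -
    have "\<bar>\<delta> \<omega> $ a * c \<omega>\<bar> \<le> norm (\<delta> \<omega>) * (C * norm (\<delta> \<omega>) ^ forest_size M)"
      unfolding abs_mult using weight that
      by (intro mult_mono component_le_norm_cart) auto
    then show ?thesis by (simp add: nvertices_Node mult_ac del: nvertices.simps)
  qed
  then have "expandable (Suc k) (\<lambda>\<omega> x. (\<delta> \<omega> $ a * c \<omega>) * forest_weight A b {#Node a M#} x)"
    by (intro expandable.weight) blast
  then show ?case
    by (rule expandable_cong) (simp add: stage_op_scale weight_Node)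
next
  case (remainder r C)
  obtain K where K: "K \<ge> 0" "\<And>u B x. admissible u \<Longrightarrow> (\<And>z. z \<in> stage_indices \<Longrightarrow> \<bar>u z\<bar> \<le> B) \<Longrightarrow>
    x \<in> stage_indices \<Longrightarrow> \<bar>stage_op A b u x\<bar> \<le> K * B"
    using stage_op_bound by blast
  have "\<bar>\<delta> \<omega> $ a * stage_op A b (r \<omega>) x\<bar> \<le> (K * C) * norm (\<delta> \<omega>) ^ Suc k"
    if "\<omega> \<in> \<Omega>" "x \<in> stage_indices" for \<omega> x
  proof -
    have "\<bar>stage_op A b (r \<omega>) x\<bar> \<le> K * (C * norm (\<delta> \<omega>) ^ k)"
      using remainder that by (intro K) auto
    then have "\<bar>\<delta> \<omega> $ a * stage_op A b (r \<omega>) x\<bar> \<le> norm (\<delta> \<omega>) * (K * (C * norm (\<delta> \<omega>) ^ k))"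
      unfolding abs_mult by (intro mult_mono component_le_norm_cart) auto
    then show ?thesis by (simp add: mult_ac)
  qed
  then show ?case
    using remainder by (intro expandable.remainder[where C = "K * C"])
      (auto intro!: admissible_mult admissible_stage_op admissible_const)
next
  case (add u v)
  then have "expandable (Suc k)
      (\<lambda>\<omega> x. \<delta> \<omega> $ a * stage_op A b (u \<omega>) x + \<delta> \<omega> $ a * stage_op A b (v \<omega>) x)"
    by (intro expandable.add)
  then show ?case
    using add by (elim expandable_cong)
      (simp add: stage_op_add expandable_admissible distrib_left)
qed

lemma expandable_iterated_dderiv:
  fixes u :: "'w \<Rightarrow> 'q stage_index \<Rightarrow> 'e::euclidean_space"
  assumes "C_b m f" "\<And>i. i \<in> Basis \<Longrightarrow> expandable k (\<lambda>\<omega> x. u \<omega> x \<bullet> i)"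
  shows "expandable k (\<lambda>\<omega> x. iterated_dderiv m (u \<omega> x) f (y \<omega>))"
  using assms(1)
proof (induction m arbitrary: f)
  case 0
  then obtain C where "\<And>y. \<bar>f y\<bar> \<le> C" by (auto simp: bounded_iff)
  then show ?case using expandable_const[of "\<lambda>\<omega>. f (y \<omega>)" C] by simp
next
  case (Suc m)
  have "expandable k (\<lambda>\<omega> x. \<Sum>i\<in>Basis. (u \<omega> x \<bullet> i) *
      iterated_dderiv m (u \<omega> x) (\<lambda>x. frechet_derivative f (at x) i) (y \<omega>))"
    using Suc.prems by (intro expandable_sum expandable_mult assms(2) Suc.IH) auto
  then show ?case
    by (simp add: iterated_dderiv_Suc_Basis[OF Suc.prems] del: iterated_dderiv.simps)
qed

text \<open>The Taylor polynomial of \<open>f\<close> at \<open>y\<close> is a polynomial in the components of \<open>u\<close> and is handled by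
  the algebra structure. As \<open>u\<close> is of order \<open>|\<delta>|\<close>, the Taylor remainder of order \<open>k\<close> is of order
  \<open>|\<delta>|\<close> to the \<open>k\<close>.\<close>

lemma expandable_compose:
  fixes u :: "'w \<Rightarrow> 'q stage_index \<Rightarrow> 'e::euclidean_space"
  assumes f: "C_b k f"
    and u: "\<And>i. i \<in> Basis \<Longrightarrow> expandable k (\<lambda>\<omega> x. u \<omega> x \<bullet> i)"
    and bound: "\<And>\<omega> x. \<omega> \<in> \<Omega> \<Longrightarrow> x \<in> stage_indices \<Longrightarrow> norm (u \<omega> x) \<le> L * norm (\<delta> \<omega>)"
  shows "expandable k (\<lambda>\<omega> x. f (y \<omega> + u \<omega> x))"
proof -
  define P where "P \<omega> x = (\<Sum>m<k. iterated_dderiv m (u \<omega> x) f (y \<omega>) / fact m)" for \<omega> x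
  obtain C where C: "\<And>y u. \<bar>f (y + u) - (\<Sum>m<k. iterated_dderiv m u f y / fact m)\<bar> \<le> C * norm u ^ k"
    using C_b_Taylor[OF f] by blast
  have "expandable k (\<lambda>\<omega> x. \<Sum>m<k. (1 / fact m) * iterated_dderiv m (u \<omega> x) f (y \<omega>))"
    using C_b_antimono[OF f]
    by (intro expandable_sum expandable_mult expandable_const expandable_iterated_dderiv u) auto
  then have P: "expandable k P" by (simp add: P_def[abs_def])
  have "admissible (\<lambda>x. f (y \<omega> + u \<omega> x))" if "\<omega> \<in> \<Omega>" for \<omega>
  proof -
    have "continuous_on {0..1} (\<lambda>s. u \<omega> (Inl s))"
      using expandable_admissible[OF u that] unfolding admissible_def
      by (subst continuous_on_componentwise) auto
    then show ?thesis
      unfolding admissible_def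
      by (intro continuous_on_compose2[OF C_b_continuous[OF f]] continuous_intros) auto
  qed
  moreover have "\<bar>f (y \<omega> + u \<omega> x) - P \<omega> x\<bar> \<le> (\<bar>C\<bar> * L ^ k) * norm (\<delta> \<omega>) ^ k"
    if "\<omega> \<in> \<Omega>" "x \<in> stage_indices" for \<omega> x
  proof -
    have "\<bar>f (y \<omega> + u \<omega> x) - P \<omega> x\<bar> \<le> C * norm (u \<omega> x) ^ k"
      unfolding P_def by (rule C)
    also have "\<dots> \<le> \<bar>C\<bar> * (L * norm (\<delta> \<omega>)) ^ k"
      by (intro mult_mono power_mono bound that) auto
    finally show ?thesis by (simp add: power_mult_distrib mult_ac)
  qed
  ultimately have "expandable k (\<lambda>\<omega> x. f (y \<omega> + u \<omega> x) - P \<omega> x)"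
    using expandable_admissible[OF P]
    by (intro remainder[where C = "\<bar>C\<bar> * L ^ k"]) (auto intro!: admissible_diff)
  from add[OF this P] show ?thesis by simp
qed

text \<open>Small forests consist of small trees, so their terms take the same value at the two indices;
  the coefficients of large forests are themselves of order \<open>|\<delta>|\<close> to the \<open>k\<close>.\<close>

lemma expandable_agree:
  assumes "expandable k u" "x \<in> stage_indices" "x' \<in> stage_indices"
    and agree: "\<And>\<tau> :: 'm ntree. nvertices \<tau> < k \<Longrightarrow> weight A b \<tau> x = weight A b \<tau> x'"
  shows "\<exists>C. \<forall>\<omega>\<in>\<Omega>. \<bar>u \<omega> x - u \<omega> x'\<bar> \<le> C * norm (\<delta> \<omega>) ^ k"
  using assms(1)
proof induction
  case (weight c C M)
  show ?case
  proof (cases "forest_size M < k")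
    case True
    then have "forest_weight A b M x = forest_weight A b M x'"
      by (induction M) (auto simp: agree)
    then show ?thesis by (auto intro: exI[of _ 0])
  next
    case False
    let ?d = "\<bar>forest_weight A b M x - forest_weight A b M x'\<bar>"
    have "\<bar>c \<omega> * forest_weight A b M x - c \<omega> * forest_weight A b M x'\<bar>
        \<le> (\<bar>C\<bar> * E ^ (forest_size M - k) * ?d) * norm (\<delta> \<omega>) ^ k" if "\<omega> \<in> \<Omega>" for \<omega>
    proof -
      have "\<bar>c \<omega>\<bar> \<le> \<bar>C\<bar> * norm (\<delta> \<omega>) ^ forest_size M"
        using weight that by (meson abs_ge_self mult_right_mono norm_ge_zero order_trans zero_le_power)
      also have "\<dots> \<le> \<bar>C\<bar> * (E ^ (forest_size M - k) * norm (\<delta> \<omega>) ^ k)"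
        using False that by (intro mult_left_mono increment_power_antimono) auto
      finally have "\<bar>c \<omega>\<bar> * ?d \<le> \<bar>C\<bar> * (E ^ (forest_size M - k) * norm (\<delta> \<omega>) ^ k) * ?d"
        by (rule mult_right_mono) simp
      then show ?thesis
        by (simp add: mult_ac flip: right_diff_distrib abs_mult)
    qed
    then show ?thesis by blast
  qed
next
  case (remainder r C)
  have "\<bar>r \<omega> x - r \<omega> x'\<bar> \<le> (2 * C) * norm (\<delta> \<omega>) ^ k" if "\<omega> \<in> \<Omega>" for \<omega>
  proof -
    have "\<bar>r \<omega> x\<bar> \<le> C * norm (\<delta> \<omega>) ^ k" "\<bar>r \<omega> x'\<bar> \<le> C * norm (\<delta> \<omega>) ^ k"
      using remainder that assms by auto
    then show ?thesis by (simp add: abs_le_iff)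
  qed
  then show ?case by blast
next
  case (add u v)
  then obtain C C' where *: "\<And>\<omega>. \<omega> \<in> \<Omega> \<Longrightarrow> \<bar>u \<omega> x - u \<omega> x'\<bar> \<le> C * norm (\<delta> \<omega>) ^ k"
    "\<And>\<omega>. \<omega> \<in> \<Omega> \<Longrightarrow> \<bar>v \<omega> x - v \<omega> x'\<bar> \<le> C' * norm (\<delta> \<omega>) ^ k"
    by blast
  have "\<bar>(u \<omega> x + v \<omega> x) - (u \<omega> x' + v \<omega> x')\<bar> \<le> (C + C') * norm (\<delta> \<omega>) ^ k" if "\<omega> \<in> \<Omega>" for \<omega>
    using *[OF that] by (simp add: distrib_right abs_le_iff)
  then show ?case by blast
qed

text \<open>Picard iteration. Boundedness of the fields gives \<open>U - y = O(|\<delta>|)\<close> for every solution \<open>U\<close>, in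
  particular for every choice of stages; each pass through the equation then raises the order by
  one.\<close>

lemma expandable_fixed_point:
  fixes U :: "'w \<Rightarrow> 'q stage_index \<Rightarrow> 'e::euclidean_space" and F :: "'m \<Rightarrow> 'e \<Rightarrow> 'e"
  assumes F: "\<And>a. C_b p (F a)"
    and cont: "\<And>\<omega>. \<omega> \<in> \<Omega> \<Longrightarrow> continuous_on {0..1} (\<lambda>s. U \<omega> (Inl s))"
    and eq: "\<And>\<omega> x i. \<omega> \<in> \<Omega> \<Longrightarrow> x \<in> stage_indices \<Longrightarrow> i \<in> Basis \<Longrightarrow>
      (U \<omega> x - y \<omega>) \<bullet> i = (\<Sum>a\<in>UNIV. \<delta> \<omega> $ a * stage_op A b (\<lambda>x. F a (U \<omega> x) \<bullet> i) x)"
    and i: "i \<in> Basis"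
  shows "expandable (Suc p) (\<lambda>\<omega> x. (U \<omega> x - y \<omega>) \<bullet> i)"
proof -
  obtain K where K: "K \<ge> 0" "\<And>u B x. admissible u \<Longrightarrow> (\<And>z. z \<in> stage_indices \<Longrightarrow> \<bar>u z\<bar> \<le> B) \<Longrightarrow>
    x \<in> stage_indices \<Longrightarrow> \<bar>stage_op A b u x\<bar> \<le> K * B"
    using stage_op_bound by blast
  have "\<forall>a. \<exists>B. \<forall>z. norm (F a z) \<le> B"
    using C_b_bounded[OF F] by (auto simp: bounded_iff)
  then obtain B where B: "\<And>a z. norm (F a z) \<le> B a" by metis
  define D where "D = (\<Sum>a\<in>UNIV. K * B a)"
  have comp_bound: "\<bar>(U \<omega> x - y \<omega>) \<bullet> i\<bar> \<le> D * norm (\<delta> \<omega>)"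
    if "\<omega> \<in> \<Omega>" "x \<in> stage_indices" "i \<in> Basis" for \<omega> x i
  proof -
    have "\<bar>stage_op A b (\<lambda>x. F a (U \<omega> x) \<bullet> i) x\<bar> \<le> K * B a" for a
    proof (rule K)
      have "continuous_on {0..1} (\<lambda>s. F a (U \<omega> (Inl s)))"
        by (rule continuous_on_compose2[OF C_b_continuous[OF F] cont]) (use that in auto)
      then show "admissible (\<lambda>x. F a (U \<omega> x) \<bullet> i)"
        unfolding admissible_def by (intro continuous_intros)
    qed (use that B Basis_le_norm order_trans in blast)+
    then have "\<bar>(U \<omega> x - y \<omega>) \<bullet> i\<bar> \<le> (\<Sum>a\<in>UNIV. norm (\<delta> \<omega>) * (K * B a))"
      unfolding eq[OF that]
      by (intro order_trans[OF sum_abs] sum_mono) (auto simp: abs_mult intro!: mult_mono component_le_norm_cart)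
    then show ?thesis by (simp add: D_def sum_distrib_left sum_distrib_right mult_ac)
  qed
  have bound: "norm (U \<omega> x - y \<omega>) \<le> (real DIM('e) * D) * norm (\<delta> \<omega>)"
    if "\<omega> \<in> \<Omega>" "x \<in> stage_indices" for \<omega> x
  proof -
    have "norm (U \<omega> x - y \<omega>) \<le> (\<Sum>i\<in>Basis. \<bar>(U \<omega> x - y \<omega>) \<bullet> i\<bar>)"
      by (rule norm_le_l1)
    also have "\<dots> \<le> (\<Sum>i\<in>(Basis::'e set). D * norm (\<delta> \<omega>))"
      by (intro sum_mono comp_bound that)
    finally show ?thesis by simp
  qed
  have "\<forall>i\<in>Basis. expandable k (\<lambda>\<omega> x. (U \<omega> x - y \<omega>) \<bullet> i)" if "k \<le> Suc p" for k
    using that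
  proof (induction k)
    case 0
    have "admissible (\<lambda>x. (U \<omega> x - y \<omega>) \<bullet> i)" if "\<omega> \<in> \<Omega>" for \<omega> i
      unfolding admissible_def by (intro continuous_intros cont that)
    moreover have "\<bar>(U \<omega> x - y \<omega>) \<bullet> i\<bar> \<le> (\<bar>D\<bar> * E) * norm (\<delta> \<omega>) ^ 0"
      if "\<omega> \<in> \<Omega>" "x \<in> stage_indices" "i \<in> Basis" for \<omega> x i
    proof -
      have "D * norm (\<delta> \<omega>) \<le> \<bar>D\<bar> * E"
        using increment_bound[OF that(1)] by (intro mult_mono) auto
      with comp_bound[OF that] show ?thesis by simp
    qed
    ultimately show ?case by (blast intro: remainder)
  next
    case (Suc k)
    show ?case
    proof
      fix i :: 'e assume i: "i \<in> Basis"
      have "expandable k (\<lambda>\<omega> x. F a (y \<omega> + (U \<omega> x - y \<omega>)) \<bullet> i)" for a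
      proof (rule expandable_compose)
        show "C_b k (\<lambda>z. F a z \<bullet> i)"
          using C_b_antimono[OF F, of k a] Suc.prems
          by (intro C_b_bounded_linear[OF bounded_linear_inner_left]) auto
      qed (use Suc bound in auto)
      then have "expandable k (\<lambda>\<omega> x. F a (U \<omega> x) \<bullet> i)" for a by simp
      then have "expandable (Suc k)
          (\<lambda>\<omega> x. \<Sum>a\<in>UNIV. \<delta> \<omega> $ a * stage_op A b (\<lambda>x. F a (U \<omega> x) \<bullet> i) x)"
        by (intro expandable_sum expandable_stage_op) auto
      then show "expandable (Suc k) (\<lambda>\<omega> x. (U \<omega> x - y \<omega>) \<bullet> i)"
        by (rule expandable_cong) (simp add: eq i)
    qed
  qed
  with i show ?thesis by blast
qed

lemma fixed_point_local_error:
  fixes U :: "'w \<Rightarrow> 'q stage_index \<Rightarrow> 'e::euclidean_space" and F :: "'m \<Rightarrow> 'e \<Rightarrow> 'e"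
  assumes F: "\<And>a. C_b p (F a)"
    and cont: "\<And>\<omega>. \<omega> \<in> \<Omega> \<Longrightarrow> continuous_on {0..1} (\<lambda>s. U \<omega> (Inl s))"
    and eq: "\<And>\<omega> x i. \<omega> \<in> \<Omega> \<Longrightarrow> x \<in> stage_indices \<Longrightarrow> i \<in> Basis \<Longrightarrow>
      (U \<omega> x - y \<omega>) \<bullet> i = (\<Sum>a\<in>UNIV. \<delta> \<omega> $ a * stage_op A b (\<lambda>x. F a (U \<omega> x) \<bullet> i) x)"
    and order: "\<And>\<tau> :: 'm ntree. nvertices \<tau> \<le> p \<Longrightarrow> na_hat A b \<tau> = 1 / real (nfactorial \<tau>)"
  shows "\<exists>C. \<forall>\<omega>\<in>\<Omega>. norm (U \<omega> (Inl 1) - U \<omega> (Inr None)) \<le> C * norm (\<delta> \<omega>) ^ Suc p"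
proof -
  have "\<exists>C. \<forall>\<omega>\<in>\<Omega>. \<bar>(U \<omega> (Inl 1) - y \<omega>) \<bullet> i - (U \<omega> (Inr None) - y \<omega>) \<bullet> i\<bar>
      \<le> C * norm (\<delta> \<omega>) ^ Suc p" if "i \<in> Basis" for i
    by (rule expandable_agree[OF expandable_fixed_point[OF F cont eq that]])
      (auto simp: order weight_update weight_time)
  then obtain C where C: "\<And>i \<omega>. i \<in> Basis \<Longrightarrow> \<omega> \<in> \<Omega> \<Longrightarrow>
      \<bar>(U \<omega> (Inl 1) - U \<omega> (Inr None)) \<bullet> i\<bar> \<le> C i * norm (\<delta> \<omega>) ^ Suc p"
    by (simp flip: inner_diff_left) metis
  have "norm (U \<omega> (Inl 1) - U \<omega> (Inr None)) \<le> (\<Sum>i\<in>Basis. C i) * norm (\<delta> \<omega>) ^ Suc p"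
    if "\<omega> \<in> \<Omega>" for \<omega>
    unfolding sum_distrib_right
    by (rule order_trans[OF norm_le_l1]) (intro sum_mono C that)
  then show ?thesis by blast
qed

end

section \<open>The local error of the simplified controlled Runge-Kutta method\<close>

lemma flow_fixed_point:
  fixes G :: "real \<Rightarrow> 'e::euclidean_space" and F :: "'m::finite \<Rightarrow> 'e \<Rightarrow> 'e" and \<delta> :: "real^'m"
  assumes cont: "continuous_on {0..1} G" and F: "\<And>a. continuous_on UNIV (F a)"
    and ode: "\<And>r. 0 < r \<Longrightarrow> r < 1 \<Longrightarrow> (G has_vector_derivative (\<Sum>a\<in>UNIV. \<delta> $ a *\<^sub>R F a (G r))) (at r)"
    and s: "0 \<le> s" "s \<le> 1"
  shows "(G s - G 0) \<bullet> i = (\<Sum>a\<in>UNIV. \<delta> $ a * integral {0..s} (\<lambda>r. F a (G r) \<bullet> i))"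
proof -
  have sub: "continuous_on {0..s} G"
    using cont s by (auto elim: continuous_on_subset)
  have "((\<lambda>r. \<Sum>a\<in>UNIV. \<delta> $ a *\<^sub>R F a (G r)) has_integral G s - G 0) {0..s}"
    using s sub ode by (intro fundamental_theorem_of_calculus_interior) auto
  from has_integral_linear[OF this bounded_linear_inner_left[of i]]
  have "((\<lambda>r. \<Sum>a\<in>UNIV. \<delta> $ a * (F a (G r) \<bullet> i)) has_integral (G s - G 0) \<bullet> i) {0..s}"
    by (simp add: o_def inner_sum_left)
  moreover have "((\<lambda>r. \<Sum>a\<in>UNIV. \<delta> $ a * (F a (G r) \<bullet> i)) has_integral
      (\<Sum>a\<in>UNIV. \<delta> $ a * integral {0..s} (\<lambda>r. F a (G r) \<bullet> i))) {0..s}"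
  proof (intro has_integral_sum has_integral_mult_right integrable_integral)
    fix a
    have "continuous_on {0..s} (\<lambda>r. F a (G r))"
      by (rule continuous_on_compose2[OF F sub]) auto
    then show "(\<lambda>r. F a (G r) \<bullet> i) integrable_on {0..s}"
      by (intro integrable_continuous_interval continuous_intros)
  qed auto
  ultimately show ?thesis by (rule has_integral_unique)
qed

theorem theorem5p8:
  fixes \<alpha> T :: real and p :: nat
    and X :: "real \<Rightarrow> real^'d" and XX :: "real \<Rightarrow> real \<Rightarrow> real^'d^'d"
    and Z :: "real \<Rightarrow> real^'m" and Z' :: "real \<Rightarrow> real^'d^'m"
    and F :: "'m \<Rightarrow> real^'e \<Rightarrow> real^'e"
    and A :: "real^'q^'q" and b :: "real^'q"
  assumes "1 / 3 < \<alpha>" and "\<alpha> \<le> 1 / 2" and "0 < T"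
    and "real (p + 1) * \<alpha> > 1"
    and "\<And>a. C_b (p + 1) (F a)"
    and "rough_path \<alpha> T X XX"
    and "controlled_path \<alpha> T X Z Z'"
    and "\<forall>\<tau>\<in>(trees_upto p :: 'm dtree set). a_hat A b \<tau> = 1 / real (tree_factorial \<tau>)"
  shows "\<forall>R>0. \<exists>C>0. \<forall>(N::nat) t y0 Y S.
    partition_of T N t \<longrightarrow>
    driven_solution N t F (pl_interp N t Z) y0 Y \<longrightarrow>
    (\<forall>n<N. scrk_stages A F Z (t n) (t (Suc n)) (Y (t n)) (S (t n) (t (Suc n)) (Y (t n)))) \<longrightarrow>
    (\<forall>n<N. norm (Y (t n)) \<le> R \<longrightarrow>
       norm (Y (t (Suc n)) - scrk_map b F Z S (t n) (t (Suc n)) (Y (t n)))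
         \<le> C * (t (Suc n) - t n) powr (real (p + 1) * \<alpha>))"
proof -
  have F: "C_b p (F a)" for a
    using C_b_antimono[OF assms(5)] by simp
  have order: "na_hat A b \<tau> = 1 / real (nfactorial \<tau>)" if "nvertices \<tau> \<le> p" for \<tau> :: "'m ntree"
    using assms(8)[rule_format, of "Some \<tau>"] that
    by (simp add: trees_upto_def vertices_def a_hat_def tree_factorial_def)
  obtain H0 where H0: "\<forall>s\<in>{0..T}. \<forall>t\<in>{0..T}. norm (Z t - Z s) \<le> H0 * \<bar>t - s\<bar> powr \<alpha>"
    using assms(7) by (auto simp: controlled_path_def holder_on_def)
  define H where "H = \<bar>H0\<bar>"
  have H: "norm (Z v - Z u) \<le> H * (v - u) powr \<alpha>" if "0 \<le> u" "u \<le> v" "v \<le> T" for u v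
  proof -
    have "norm (Z v - Z u) \<le> H0 * (v - u) powr \<alpha>" using H0[rule_format, of u v] that by auto
    also have "\<dots> \<le> H * (v - u) powr \<alpha>" by (intro mult_right_mono) (auto simp: H_def)
    finally show ?thesis .
  qed
  define E where "E = H * T powr \<alpha>"
  \<comment> \<open>All increments up to the size attained on \<open>[0,T]\<close>, all starting points and all solutions are
    collected, which yields one constant for every partition and every step.\<close>
  define \<Omega> :: "((real^'m) \<times> (real^'e) \<times> ('q stage_index \<Rightarrow> real^'e)) set" where
    "\<Omega> = {(\<delta>, y, U). norm \<delta> \<le> E \<and> continuous_on {0..1} (\<lambda>s. U (Inl s)) \<and>
      (\<forall>x\<in>stage_indices. \<forall>i\<in>Basis.
        (U x - y) \<bullet> i = (\<Sum>a\<in>UNIV. \<delta> $ a * stage_op A b (\<lambda>x. F a (U x) \<bullet> i) x))}"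
  interpret increment_family A b \<Omega> fst E
    by unfold_locales (auto simp: \<Omega>_def)
  have "\<exists>C. \<forall>\<omega>\<in>\<Omega>. norm (snd (snd \<omega>) (Inl 1) - snd (snd \<omega>) (Inr None)) \<le> C * norm (fst \<omega>) ^ Suc p"
    by (rule fixed_point_local_error[where y = "fst \<circ> snd" and F = F])
      (auto simp: \<Omega>_def F order)
  then obtain C where C: "\<And>\<delta> y U. (\<delta>, y, U) \<in> \<Omega> \<Longrightarrow>
      norm (U (Inl 1) - U (Inr None)) \<le> C * norm \<delta> ^ Suc p"
    by fastforce
  have error: "norm (Y (t (Suc n)) - scrk_map b F Z S (t n) (t (Suc n)) (Y (t n)))
      \<le> (\<bar>C\<bar> * H ^ Suc p + 1) * (t (Suc n) - t n) powr (real (p + 1) * \<alpha>)"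
    if P: "partition_of T N t" and sol: "driven_solution N t F (pl_interp N t Z) y0 Y"
      and stages: "scrk_stages A F Z (t n) (t (Suc n)) (Y (t n)) (S (t n) (t (Suc n)) (Y (t n)))"
      and n: "n < N" for N t y0 Y S n
  proof -
    define h where "h = t (Suc n) - t n"
    define \<delta> where "\<delta> = Z (t (Suc n)) - Z (t n)"
    define U :: "'q stage_index \<Rightarrow> real^'e" where
      "U x = (case x of Inl s \<Rightarrow> Y (t n + s * h)
        | Inr None \<Rightarrow> scrk_map b F Z S (t n) (t (Suc n)) (Y (t n))
        | Inr (Some i) \<Rightarrow> S (t n) (t (Suc n)) (Y (t n)) i)" for x
    have h: "h > 0" using P n by (simp add: h_def partition_of_def)
    have t: "0 \<le> t n" "t (Suc n) \<le> T" "t n + h = t (Suc n)"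
      using P partition_of_mono[OF P, of 0 n] partition_of_mono[OF P, of "Suc n" N] n
      by (auto simp: partition_of_def h_def)
    have \<delta>: "norm \<delta> \<le> H * h powr \<alpha>"
      using H[of "t n" "t (Suc n)"] h t unfolding \<delta>_def h_def by simp
    have Y: "continuous_on {0..T} Y"
      "\<And>r. r \<in> {t n<..<t (Suc n)} \<Longrightarrow>
        (Y has_vector_derivative (\<Sum>a\<in>UNIV. (\<delta> $ a / h) *\<^sub>R F a (Y r))) (at r)"
      using sol n unfolding driven_solution_pl_interp_iff[OF P] by (auto simp: \<delta>_def h_def)
    have inside: "t n + s * h \<in> {0..T}" if "0 \<le> s" "s \<le> 1" for s
    proof -
      have "0 \<le> s * h" "s * h \<le> h" using that h by (auto simp: mult_left_le_one_le)
      then show ?thesis using t unfolding atLeastAtMost_iff by linarith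
    qed
    have contU: "continuous_on {0..1} (\<lambda>s. U (Inl s))"
      unfolding U_def using inside
      by (auto intro!: continuous_on_compose2[OF Y(1)] continuous_intros)
    have odeU: "((\<lambda>s. U (Inl s)) has_vector_derivative (\<Sum>a\<in>UNIV. \<delta> $ a *\<^sub>R F a (U (Inl r)))) (at r)"
      if r: "0 < r" "r < 1" for r
    proof -
      have "0 < r * h" "r * h < h" using r h by auto
      then have "t n + r * h \<in> {t n<..<t (Suc n)}"
        using t unfolding greaterThanLessThan_iff by linarith
      from Y(2)[OF this]
      have "(Y \<circ> (\<lambda>s. t n + s * h) has_vector_derivative
          h *\<^sub>R (\<Sum>a\<in>UNIV. (\<delta> $ a / h) *\<^sub>R F a (Y (t n + r * h)))) (at r)"
        by (intro vector_diff_chain_at) (auto intro!: derivative_eq_intros simp: has_vector_derivative_def)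
      then show ?thesis
        using h by (simp add: U_def o_def scaleR_sum_right)
    qed
    have "(U x - Y (t n)) \<bullet> i = (\<Sum>a\<in>UNIV. \<delta> $ a * stage_op A b (\<lambda>x. F a (U x) \<bullet> i) x)"
      if "x \<in> stage_indices" for x i
      using that
    proof (cases rule: stage_index_cases)
      case (time s)
      then show ?thesis
        using flow_fixed_point[OF contU C_b_continuous[OF F] odeU, of s i]
        by (simp add: U_def stage_op_def)
    next
      case update
      then show ?thesis
        by (simp add: U_def stage_op_def scrk_map_def \<delta>_def inner_sum_left sum_distrib_left mult_ac)
    next
      case (stage j)
      have "U x = Y (t n) + (\<Sum>a\<in>UNIV. \<Sum>l\<in>UNIV. (A $ j $ l * \<delta> $ a) *\<^sub>R F a (U (Inr (Some l))))"
        using stages[unfolded scrk_stages_def, rule_format, of j]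
        unfolding stage U_def \<delta>_def sum.case option.case vector_minus_component .
      then have diff: "U x - Y (t n) = (\<Sum>a\<in>UNIV. \<Sum>l\<in>UNIV. (A $ j $ l * \<delta> $ a) *\<^sub>R F a (U (Inr (Some l))))"
        by (simp only: add_diff_cancel_left')
      show ?thesis
        unfolding diff by (simp add: stage stage_op_def inner_sum_left sum_distrib_left mult_ac)
    qed
    moreover have "norm \<delta> \<le> E"
    proof -
      have "h powr \<alpha> \<le> T powr \<alpha>"
        using h t assms(1) by (intro powr_mono2) auto
      then have "H * h powr \<alpha> \<le> E"
        unfolding E_def by (intro mult_left_mono) (auto simp: H_def)
      with \<delta> show ?thesis by simp
    qed
    ultimately have "(\<delta>, Y (t n), U) \<in> \<Omega>"
      using contU by (simp add: \<Omega>_def)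
    from C[OF this]
    have "norm (Y (t (Suc n)) - scrk_map b F Z S (t n) (t (Suc n)) (Y (t n))) \<le> C * norm \<delta> ^ Suc p"
      by (simp add: U_def t)
    also have "\<dots> \<le> \<bar>C\<bar> * (H * h powr \<alpha>) ^ Suc p"
      by (intro mult_mono power_mono \<delta>) auto
    also have "(H * h powr \<alpha>) ^ Suc p = H ^ Suc p * h powr (real (p + 1) * \<alpha>)"
      using h by (simp add: power_mult_distrib powr_powr mult_ac flip: powr_realpow del: power_Suc)
    also have "\<bar>C\<bar> * (H ^ Suc p * h powr (real (p + 1) * \<alpha>))
        \<le> (\<bar>C\<bar> * H ^ Suc p + 1) * h powr (real (p + 1) * \<alpha>)"
      unfolding distrib_right mult.assoc by simp
    finally show ?thesis by (simp add: h_def)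
  qed
  have "\<bar>C\<bar> * H ^ Suc p + 1 > 0"
    by (intro add_nonneg_pos) (auto simp: H_def)
  with error show ?thesis
    by (intro allI impI exI[of _ "\<bar>C\<bar> * H ^ Suc p + 1"] conjI) auto
qed

end
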